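(* Let $n=n(k)$ be a function of $k$ with $k\le n(k)\le \exp(o(k))$ (i.e. $\log n(k)/k\to 0$ as $k\to\infty$), and let $0<\varepsilon,\delta<1$. There exists $k_0=k_0(\varepsilon,\delta)$ such that for all $k\ge k_0$: (1) if $p\ge \frac{(1+\varepsilon)\log n}{k}$, then $\mathbb{P}[\mathbb{G}(k,n,p)\text{ has NMP}]\ge 1-\delta$; (2) if $p\le \frac{(1-\varepsilon)\log n}{k}$, then $\mathbb{P}[\mathbb{G}(k,n,p)\text{ has NMP}]\le \delta$.
   Context: $\log$ denotes the natural logarithm. $\mathbb{G}(k,n,p)$ is the random bipartite graph with vertex classes $X,Y$, $|X|=k$, $|Y|=n$, in which each pair $(x,y)\in X\times Y$ is an edge independently with probability $p$. A bipartite graph $G(X,Y)$ with vertex classes $X,Y$ has the Normalized Matching Property (NMP) if for every $S\subseteq X$, $\frac{|N(S)|}{|Y|}\ge \frac{|S|}{|X|}$, where $N(S)\subseteq Y$ is the set of vertices adjacent to some vertex of $S$. *)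

theory Defs
  imports "HOL-Probability.Probability"
begin

text \<open>
  A bipartite graph with vertex classes \<open>X\<close> and \<open>Y\<close> is given by its edge set \<open>E \<subseteq> X \<times> Y\<close>.  The pair
  \<open>(x, y)\<close> always has its first component in \<open>X\<close> and its second in \<open>Y\<close>, so the two classes are
  treated as disjoint even when both are sets of natural numbers.
\<close>

definition bip_neighbours :: "'b set \<Rightarrow> ('a \<times> 'b) set \<Rightarrow> 'a set \<Rightarrow> 'b set" where
  "bip_neighbours Y E S = {y \<in> Y. \<exists>x\<in>S. (x, y) \<in> E}"

definition NMP :: "'a set \<Rightarrow> 'b set \<Rightarrow> ('a \<times> 'b) set \<Rightarrow> bool" where
  "NMP X Y E \<longleftrightarrow>
     (\<forall>S\<subseteq>X. real (card (bip_neighbours Y E S)) / real (card Y) \<ge> real (card S) / real (card X))"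

text \<open>
  The random edge set is the set of pairs whose indicator is true; the default value \<open>False\<close>
  rules out edges outside \<open>X \<times> Y\<close>.  The definition is meant for finite \<open>X\<close>, \<open>Y\<close> and
  \<open>0 \<le> p \<le> 1\<close> (\<open>bernoulli_pmf\<close> truncates other values of \<open>p\<close> to this interval).
\<close>

definition random_bip :: "'a set \<Rightarrow> 'b set \<Rightarrow> real \<Rightarrow> ('a \<times> 'b) set pmf" where
  "random_bip X Y p =
     map_pmf (\<lambda>f. {e. f e}) (Pi_pmf (X \<times> Y) False (\<lambda>_. bernoulli_pmf p))"

definition prob_NMP :: "nat \<Rightarrow> nat \<Rightarrow> real \<Rightarrow> real" where
  "prob_NMP k n p =
     measure_pmf.prob (random_bip {..<k} {..<n} p) {E. NMP {..<k} {..<n} E}"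

end

(*
  If NMP fails, there are nonempty S in X and T in Y with no edge between them and |S|/k + |T|/n > 1.
  A union bound over such pairs is too weak when S or T is small (already for n = k), because there
  are too many choices for the larger set.  If |T| <= c k with c a small multiple of \<epsilon>, one takes a
  union bound over T only and estimates the lower tail of |N(T)|, a binomial variable, by the
  Chernoff method with E z^|N(T)| for z = n^(-\<epsilon>/6); this beats the n^|T| choices of T.  The case
  |S| <= c k is symmetric.  When both sets have more than c k elements, the union bound over pairs
  suffices.  Below the threshold, the number of isolated vertices of Y has mean at least
  n^(\<epsilon>^2), and the events that the vertices of Y are isolated are independent, so some vertex of
  Y is isolated with high probability, which contradicts NMP for S = X.
*)

theory Submission
  imports Defs
begin

section \<open>Independent Bernoulli indicators grouped into disjoint blocks\<close>

abbreviation bernoulli_field :: "'i set \<Rightarrow> real \<Rightarrow> ('i \<Rightarrow> bool) pmf" where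
  "bernoulli_field I p \<equiv> Pi_pmf I False (\<lambda>_. bernoulli_pmf p)"

lemma finite_set_bernoulli_field: "finite I \<Longrightarrow> finite (set_pmf (bernoulli_field I p))"
  by (rule finite_subset[OF set_Pi_pmf_subset']) (auto intro!: finite_PiE_dflt)

lemma prob_bernoulli_field_all_False:
  assumes "finite I" "M \<subseteq> I" "0 \<le> p" "p \<le> 1"
  shows "measure_pmf.prob (bernoulli_field I p) {f. \<forall>e\<in>M. \<not> f e} = (1 - p) ^ card M"
proof -
  have "{f. \<forall>e\<in>M. \<not> f e} = Pi I (\<lambda>e. if e \<in> M then {False} else UNIV)"
    using assms(2) by (auto simp: Pi_def)
  then have "measure_pmf.prob (bernoulli_field I p) {f. \<forall>e\<in>M. \<not> f e} =
      (\<Prod>e\<in>I. measure_pmf.prob (bernoulli_pmf p) (if e \<in> M then {False} else UNIV))"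
    using assms(1) by (simp only: measure_Pi_pmf_Pi)
  also have "\<dots> = (\<Prod>e\<in>I. if e \<in> M then 1 - p else 1)"
    using assms by (intro prod.cong) (auto simp: measure_pmf_single)
  also have "\<dots> = (1 - p) ^ card M"
    using assms by (simp add: prod.If_cases Int_absorb1)
  finally show ?thesis .
qed

text \<open>Each factor is \<open>u\<close> plus \<open>v - u\<close> times the indicator that its
  block is missed. Expanding the product over subsets \<open>C\<close> of \<open>B\<close> leaves
  only the probabilities that all blocks in \<open>C\<close> are missed. Disjointness makes these
  powers of \<open>(1 - p) ^ t\<close>, and the sum folds back into a single power. Taking
  \<open>u = z\<close>, \<open>v = 1\<close> gives the Chernoff moment; \<open>u = 1\<close>,
  \<open>v = 0\<close> gives the probability that every block is hit.\<close>

lemma expectation_bernoulli_field_blocks: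
  fixes u v :: real and D :: "'b \<Rightarrow> 'i set"
  assumes I: "finite I" and B: "finite B" and D: "\<And>y. y \<in> B \<Longrightarrow> D y \<subseteq> I"
    and disj: "disjoint_family_on D B" and card: "\<And>y. y \<in> B \<Longrightarrow> card (D y) = t"
    and p: "0 \<le> p" "p \<le> 1"
  shows "measure_pmf.expectation (bernoulli_field I p)
           (\<lambda>f. \<Prod>y\<in>B. if \<exists>e\<in>D y. f e then u else v) =
         (v * (1 - p) ^ t + u * (1 - (1 - p) ^ t)) ^ card B"
proof -
  let ?P = "bernoulli_field I p"
  let ?A = "\<lambda>C. {f. \<forall>e\<in>(\<Union>y\<in>C. D y). \<not> f e}"
  have "(\<Prod>y\<in>B. if \<exists>e\<in>D y. f e then u else v) =
      (\<Sum>C\<in>Pow B. (v - u) ^ card C * u ^ card (B - C) * indicator (?A C) f)" for f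
  proof -
    have "(\<Prod>y\<in>B. if \<exists>e\<in>D y. f e then u else v) =
        (\<Prod>y\<in>B. (v - u) * of_bool (\<forall>e\<in>D y. \<not> f e) + u)"
      by (intro prod.cong) auto
    also have "\<dots> = (\<Sum>C\<in>Pow B. (v - u) ^ card C * (\<Prod>y\<in>C. of_bool (\<forall>e\<in>D y. \<not> f e))
        * u ^ card (B - C))"
      using B by (simp add: prod_add prod.distrib)
    also have "\<dots> = (\<Sum>C\<in>Pow B. (v - u) ^ card C * u ^ card (B - C) * indicator (?A C) f)"
    proof (intro sum.cong refl)
      fix C assume "C \<in> Pow B"
      then have "finite C" using B finite_subset by auto
      then have "(\<Prod>y\<in>C. of_bool (\<forall>e\<in>D y. \<not> f e)) = (indicator (?A C) f :: real)"
        by (induction C rule: finite_induct) (auto simp: indicator_def)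
      then show "(v - u) ^ card C * (\<Prod>y\<in>C. of_bool (\<forall>e\<in>D y. \<not> f e)) * u ^ card (B - C) =
          (v - u) ^ card C * u ^ card (B - C) * indicator (?A C) f"
        by simp
    qed
    finally show ?thesis .
  qed
  then have "measure_pmf.expectation ?P (\<lambda>f. \<Prod>y\<in>B. if \<exists>e\<in>D y. f e then u else v) =
      (\<Sum>C\<in>Pow B. (v - u) ^ card C * u ^ card (B - C) * measure_pmf.prob ?P (?A C))"
    by (simp add: integrable_measure_pmf_finite finite_set_bernoulli_field[OF I])
  also have "\<dots> = (\<Sum>C\<in>Pow B. ((v - u) * (1 - p) ^ t) ^ card C * u ^ card (B - C))"
  proof (intro sum.cong refl)
    fix C assume C: "C \<in> Pow B"
    then have "finite C" using B finite_subset by auto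
    moreover have "finite (D y)" if "y \<in> C" for y
      using C D I that finite_subset by blast
    ultimately have "card (\<Union>y\<in>C. D y) = (\<Sum>y\<in>C. card (D y))"
      using C disj by (intro card_UN_disjoint) (auto simp: disjoint_family_on_def subset_iff)
    also have "\<dots> = t * card C" using C card by (simp add: subset_iff)
    finally have "measure_pmf.prob ?P (?A C) = (1 - p) ^ (t * card C)"
      using C D I p by (subst prob_bernoulli_field_all_False) auto
    then show "(v - u) ^ card C * u ^ card (B - C) * measure_pmf.prob ?P (?A C) =
        ((v - u) * (1 - p) ^ t) ^ card C * u ^ card (B - C)"
      by (simp add: power_mult_distrib power_mult)
  qed
  also have "\<dots> = (\<Prod>y\<in>B. (v - u) * (1 - p) ^ t + u)"
    using prod_add[OF B, of "\<lambda>_. (v - u) * (1 - p) ^ t" "\<lambda>_. u"] by simp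
  also have "\<dots> = (v * (1 - p) ^ t + u * (1 - (1 - p) ^ t)) ^ card B"
    by (simp add: algebra_simps)
  finally show ?thesis .
qed

text \<open>Chernoff's method: since \<open>z <= 1\<close>, the power of \<open>z\<close> with
  exponent (number of hits) - \<open>m\<close> is at least 1 on the event, and its mean is the block
  expectation with \<open>u = z\<close>, \<open>v = 1\<close>, up to the constant factor.\<close>

lemma prob_few_blocks_hit_le:
  fixes D :: "'b \<Rightarrow> 'i set" and m z :: real
  assumes I: "finite I" and B: "finite B" and D: "\<And>y. y \<in> B \<Longrightarrow> D y \<subseteq> I"
    and disj: "disjoint_family_on D B" and card: "\<And>y. y \<in> B \<Longrightarrow> card (D y) = t"
    and p: "0 \<le> p" "p \<le> 1" and z: "0 < z" "z \<le> 1"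
  shows "measure_pmf.prob (bernoulli_field I p) {f. real (card {y \<in> B. \<exists>e\<in>D y. f e}) \<le> m} \<le>
         z powr (- m) * ((1 - p) ^ t + z * (1 - (1 - p) ^ t)) ^ card B"
proof -
  let ?P = "bernoulli_field I p"
  let ?N = "\<lambda>f. card {y \<in> B. \<exists>e\<in>D y. f e}"
  have prod: "(\<Prod>y\<in>B. if \<exists>e\<in>D y. f e then z else 1) = z ^ ?N f" for f
    using B by (simp add: prod.If_cases Int_def)
  have "measure_pmf.prob ?P {f. real (?N f) \<le> m} =
      measure_pmf.expectation ?P (indicator {f. real (?N f) \<le> m})"
    by simp
  also have "\<dots> \<le> measure_pmf.expectation ?P (\<lambda>f. z powr (- m) * z ^ ?N f)"
  proof (intro integral_mono)
    fix f
    have "1 \<le> z powr (- m) * z ^ ?N f" if "real (?N f) \<le> m"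
    proof -
      have "z powr 0 \<le> z powr (real (?N f) - m)"
        using that z by (intro powr_mono') auto
      then show ?thesis
        using z by (simp add: powr_add powr_realpow flip: powr_realpow)
          (simp add: powr_diff powr_minus field_simps)
    qed
    then show "indicator {f. real (?N f) \<le> m} f \<le> z powr (- m) * z ^ ?N f"
      using z by (auto simp: indicator_def)
  qed (auto intro: integrable_measure_pmf_finite finite_set_bernoulli_field[OF I])
  also have "\<dots> = z powr (- m) * ((1 - p) ^ t + z * (1 - (1 - p) ^ t)) ^ card B"
    using expectation_bernoulli_field_blocks[OF I B D disj card p, of z 1] by (simp add: prod)
  finally show ?thesis .
qed

lemma prob_all_blocks_hit:
  fixes D :: "'b \<Rightarrow> 'i set"
  assumes I: "finite I" and B: "finite B" and D: "\<And>y. y \<in> B \<Longrightarrow> D y \<subseteq> I"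
    and disj: "disjoint_family_on D B" and card: "\<And>y. y \<in> B \<Longrightarrow> card (D y) = t"
    and p: "0 \<le> p" "p \<le> 1"
  shows "measure_pmf.prob (bernoulli_field I p) {f. \<forall>y\<in>B. \<exists>e\<in>D y. f e} =
         (1 - (1 - p) ^ t) ^ card B"
proof -
  let ?P = "bernoulli_field I p"
  have prod: "(\<Prod>y\<in>B. if \<exists>e\<in>D y. f e then 1 else 0) =
      (indicator {f. \<forall>y\<in>B. \<exists>e\<in>D y. f e} f :: real)" for f
    using B by (induction B rule: finite_induct) (auto simp: indicator_def)
  show ?thesis
    using expectation_bernoulli_field_blocks[OF I B D disj card p, of 1 0] by (simp add: prod)
qed

section \<open>Failure of NMP as a pair of sets without edges, and elementary estimates\<close>

lemma sum_power_card_Pow: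
  assumes "finite A"
  shows "(\<Sum>T\<in>Pow A. w ^ card T) = (1 + w :: real) ^ card A"
  using prod_add[OF assms, of "\<lambda>_. w" "\<lambda>_. 1"] by (simp add: add.commute)

text \<open>\<open>T\<close> is the complement of the neighbourhood of a set \<open>S\<close> that
  violates NMP. In this form the two classes play symmetric roles, so the argument for small
  \<open>S\<close> can be reused for small \<open>T\<close>.\<close>

lemma not_NMP_obtain:
  assumes X: "finite X" "X \<noteq> {}" and Y: "finite Y" "Y \<noteq> {}" and "\<not> NMP X Y E"
  obtains S T where "S \<subseteq> X" "T \<subseteq> Y" "S \<noteq> {}" "T \<noteq> {}" "\<And>x y. x \<in> S \<Longrightarrow> y \<in> T \<Longrightarrow> (x, y) \<notin> E"
    "1 < real (card S) / real (card X) + real (card T) / real (card Y)"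
proof -
  obtain S where S: "S \<subseteq> X"
      "real (card (bip_neighbours Y E S)) / real (card Y) < real (card S) / real (card X)"
    using assms(5) by (auto simp: NMP_def not_le)
  let ?T = "Y - bip_neighbours Y E S"
  have sub: "bip_neighbours Y E S \<subseteq> Y" by (auto simp: bip_neighbours_def)
  have cT: "real (card ?T) = real (card Y) - real (card (bip_neighbours Y E S))"
    using sub Y by (simp add: card_Diff_subset finite_subset card_mono of_nat_diff)
  have pos: "card X > 0" "card Y > 0" using X Y by (auto simp: card_gt_0_iff)
  have *: "1 < real (card S) / real (card X) + real (card ?T) / real (card Y)"
    using S(2) pos unfolding cT by (simp add: diff_divide_distrib)
  have le: "real (card S) / real (card X) \<le> 1"
    using S(1) X pos by (simp add: card_mono)
  have "0 \<le> real (card (bip_neighbours Y E S)) / real (card Y)"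
    by (intro divide_nonneg_nonneg) auto
  then have "0 < real (card S) / real (card X)" using S(2) by linarith
  then have "S \<noteq> {}" by auto
  moreover have "?T \<noteq> {}"
  proof
    assume T: "?T = {}"
    show False using * le unfolding T by simp
  qed
  moreover have "(x, y) \<notin> E" if "x \<in> S" "y \<in> ?T" for x y
    using that by (auto simp: bip_neighbours_def)
  ultimately show ?thesis using that[of S ?T] S(1) * by blast
qed

text \<open>Separating \<open>q\<close> from \<open>p\<close> lets estimates at the threshold value
  \<open>q\<close> cover every larger \<open>p\<close>, with no appeal to monotonicity of
  NMP.\<close>

lemma one_minus_power_le_exp:
  fixes p q :: real
  assumes "q \<le> p" "p \<le> 1"
  shows "(1 - p) ^ m \<le> exp (- (q * real m))"
proof -
  have "1 - p \<le> exp (- q)" using exp_ge_add_one_self[of "- q"] assms(1) by simp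
  then have "(1 - p) ^ m \<le> exp (- q) ^ m" using assms(2) by (intro power_mono) auto
  then show ?thesis by (simp add: mult.commute flip: exp_of_nat_mult)
qed

lemma powr_power_eq_exp: "0 < x \<Longrightarrow> (x powr a) ^ m = exp (a * (real m * ln x))"
  by (simp add: powr_def mult_ac flip: exp_of_nat_mult)

section \<open>Small sets: a Chernoff bound, then a union bound over one class\<close>

text \<open>In the application \<open>t\<close> is the size of a small set in a class of size
  \<open>a\<close>, \<open>B\<close> is the other class, and \<open>D y\<close> holds the pairs
  joining \<open>y\<close> to that set. A class of at most \<open>n\<close> vertices has at most n^t
  such sets, so the bound leaves a surplus factor n^(-\<epsilon> t/2). As \<open>k\<close> only has
  to be at most both class sizes, either class can serve as \<open>B\<close>.\<close>

lemma prob_small_neighbourhood_le: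
  fixes D :: "'b \<Rightarrow> 'i set" and \<epsilon> p :: real and a k n t :: nat
  assumes I: "finite I" and B: "finite B" and D: "\<And>y. y \<in> B \<Longrightarrow> D y \<subseteq> I"
    and disj: "disjoint_family_on D B" and card: "\<And>y. y \<in> B \<Longrightarrow> card (D y) = t"
    and eps: "0 < \<epsilon>" "\<epsilon> < 1" and k: "0 < k" "k \<le> a" "k \<le> card B" and n: "1 \<le> n"
    and large: "- ln (\<epsilon> / 6) \<le> \<epsilon> / 12 * ln (real n)"
    and t: "real t \<le> \<epsilon> / 24 * real k"
    and p: "0 \<le> p" "p \<le> 1" "(1 + \<epsilon>) * ln (real n) / real k \<le> p"
  shows "measure_pmf.prob (bernoulli_field I p)
           {f. real (card {y \<in> B. \<exists>e\<in>D y. f e}) \<le> real (card B) * real t / real a}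
         \<le> (real n powr (- (1 + \<epsilon> / 2))) ^ t"
proof -
  define L where "L = ln (real n)"
  define e where "e = \<epsilon> / 6"
  \<comment> \<open>\<open>1 / z\<close> may be as large as a small power of \<open>n\<close>, since it enters only with exponent \<open>|B| t / a\<close>.\<close>
  define z where "z = exp (- (e * L))"
  \<comment> \<open>\<open>x\<close> is \<open>t\<close> times the threshold probability, so exp(-x)
    bounds the chance \<open>r\<close> that a block is missed.\<close>
  define x where "x = (1 + \<epsilon>) * L / real k * real t"
  define b where "b = real (card B)"
  define r where "r = (1 - p) ^ t"
  have L: "0 \<le> L" using n by (simp add: L_def)
  have e: "0 < e" "e < 1" using eps by (auto simp: e_def)
  have z: "0 < z" "z \<le> 1" using L e by (auto simp: z_def)
  have k': "0 < real k" "real k \<le> real a" "real k \<le> b" using k by (auto simp: b_def)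
  have x0: "0 \<le> x" using L eps k' by (simp add: x_def)
  have r: "0 \<le> r" "r \<le> exp (- x)"
    using one_minus_power_le_exp[OF p(3) p(2), of t] p by (auto simp: r_def x_def L_def)
  \<comment> \<open>The constant \<epsilon>/24 in the bound on \<open>t\<close> ensures, with 1 +
    \<epsilon> < 2, that exp(-x) is at least the square root of \<open>z\<close>.\<close>
  have xL: "x \<le> e / 2 * L"
  proof -
    have "x = ((1 + \<epsilon>) * L) * (real t / real k)" by (simp add: x_def)
    also have "\<dots> \<le> (2 * L) * (\<epsilon> / 24)"
      using eps L k' t by (intro mult_mono) (auto simp: field_simps)
    also have "(2 * L) * (\<epsilon> / 24) = e / 2 * L" by (simp add: e_def)
    finally show ?thesis .
  qed
  \<comment> \<open>Split \<open>z\<close> into two square roots: one is at most \<open>e\<close> by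
    \<open>large\<close>, the other at most exp(-x). Hence adding \<open>z * x\<close> to exp(-x)
    costs at most a factor 1 + e x, which only lowers the decay rate from \<open>x\<close> to
    \<open>(1 - e) * x\<close>.\<close>
  have "z * x \<le> (e * exp (- x)) * x"
  proof (intro mult_right_mono x0)
    have "exp (- (e / 2 * L)) \<le> exp (ln e)"
      using large by (subst exp_le_cancel_iff) (simp add: e_def L_def)
    then have "exp (- (e / 2 * L)) \<le> e" using e by simp
    have "z = exp (- (e / 2 * L)) * exp (- (e / 2 * L))" by (simp add: z_def flip: exp_add)
    also have "\<dots> \<le> e * exp (- (e / 2 * L))"
      using \<open>exp (- (e / 2 * L)) \<le> e\<close> by (intro mult_right_mono) auto
    also have "\<dots> \<le> e * exp (- x)" using xL e by simp
    finally show "z \<le> e * exp (- x)" .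
  qed
  moreover have "z * (1 - exp (- x)) \<le> z * x"
    using exp_ge_add_one_self[of "- x"] z by (intro mult_left_mono) auto
  moreover have "exp (- x) * (e * x) \<le> exp (- x) * (exp (e * x) - 1)"
    by (rule mult_left_mono) (use exp_ge_add_one_self[of "e * x"] in linarith, simp)
  ultimately have "exp (- x) + z * (1 - exp (- x)) \<le> exp (- x) * exp (e * x)"
    by (simp add: algebra_simps)
  also have "\<dots> = exp (- x + e * x)" by (simp only: exp_add)
  also have "- x + e * x = - ((1 - e) * x)" by (simp add: algebra_simps)
  finally have base: "exp (- x) + z * (1 - exp (- x)) \<le> exp (- ((1 - e) * x))" .
  \<comment> \<open>Since \<open>z <= 1\<close>, the expression \<open>r + z * (1 - r)\<close> is
    nondecreasing in \<open>r\<close>, so \<open>r\<close> may be replaced by its upper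
    bound.\<close>
  have "r * (1 - z) \<le> exp (- x) * (1 - z)" using r z by (intro mult_right_mono) auto
  then have "r + z * (1 - r) \<le> exp (- ((1 - e) * x))"
    using base by (simp add: algebra_simps)
  moreover have "0 \<le> r + z * (1 - r)"
    using r z p by (simp add: r_def power_le_one)
  ultimately have pow: "(r + z * (1 - r)) ^ card B \<le> exp (- ((1 - e) * x) * b)"
    using power_mono[of "r + z * (1 - r)" "exp (- ((1 - e) * x))" "card B"]
    by (simp add: b_def mult.commute flip: exp_of_nat_mult)
  \<comment> \<open>A common unit for the exponents: the Chernoff prefactor costs at most
    \<open>e * u\<close>, while the power gains
    \<open>(1 - e) * (1 + \<epsilon>) * u\<close>.\<close>
  define u where "u = b / real k * real t * L"
  have u: "real t * L \<le> u"
    using k' L mult_right_mono[of 1 "b / real k" "real t * L"] by (simp add: u_def)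
  have "z powr (- (b * real t / real a)) = exp (e * L * (b * real t / real a))"
    by (simp add: z_def powr_def)
  also have "\<dots> \<le> exp (e * L * (b * real t / real k))"
    using e L k' by (intro exp_le_cancel_iff[THEN iffD2] mult_left_mono divide_left_mono) auto
  finally have zp: "z powr (- (b * real t / real a)) \<le> exp (e * u)"
    by (simp add: u_def mult_ac)
  have xb: "x * b = (1 + \<epsilon>) * u" by (simp add: x_def u_def)
  have "- ((1 - e) * x) * b = - ((1 - e) * (x * b))" by simp
  then have exponent: "e * u + - ((1 - e) * x) * b = - (((1 - e) * (1 + \<epsilon>) - e) * u)"
    unfolding xb by (simp add: algebra_simps)
  have "measure_pmf.prob (bernoulli_field I p)
           {f. real (card {y \<in> B. \<exists>e\<in>D y. f e}) \<le> b * real t / real a}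
        \<le> z powr (- (b * real t / real a)) * (r + z * (1 - r)) ^ card B"
    using prob_few_blocks_hit_le[OF I B D disj card p(1,2) z] by (simp add: r_def)
  also have "\<dots> \<le> exp (e * u) * exp (- ((1 - e) * x) * b)"
    using zp pow by (intro mult_mono) (auto simp: \<open>0 \<le> r + z * (1 - r)\<close>)
  also have "exp (e * u) * exp (- ((1 - e) * x) * b) = exp (- (((1 - e) * (1 + \<epsilon>) - e) * u))"
    by (simp only: exponent flip: exp_add)
  also have "\<dots> \<le> exp (- ((1 + \<epsilon> / 2) * (real t * L)))"
  proof -
    \<comment> \<open>The total loss e(2 + \<epsilon>) is at most 3e = \<epsilon>/2; this fixes the
      choice e = \<epsilon>/6.\<close>
    have "e * (2 + \<epsilon>) \<le> e * 3" using eps e by (intro mult_left_mono) auto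
    then have "1 + \<epsilon> / 2 \<le> (1 - e) * (1 + \<epsilon>) - e" by (simp add: e_def algebra_simps)
    then have "(1 + \<epsilon> / 2) * (real t * L) \<le> ((1 - e) * (1 + \<epsilon>) - e) * u"
      using u L eps by (intro mult_mono) auto
    then show ?thesis by simp
  qed
  also have "\<dots> = (real n powr (- (1 + \<epsilon> / 2))) ^ t"
    using n by (simp only: powr_power_eq_exp[of "real n"] L_def mult_minus_left)
  finally show ?thesis by (simp add: b_def)
qed

text \<open>
  The injection \<open>g\<close> allows \<open>A\<close> to be either of the two vertex classes.
\<close>
lemma prob_exists_small_deficient_le:
  fixes g :: "'a \<Rightarrow> 'b \<Rightarrow> 'i" and \<epsilon> p :: real and k n :: nat
  assumes I: "finite I" and A: "finite A" and B: "finite B"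
    and gI: "\<And>x y. x \<in> A \<Longrightarrow> y \<in> B \<Longrightarrow> g x y \<in> I" and inj: "inj_on (case_prod g) (A \<times> B)"
    and eps: "0 < \<epsilon>" "\<epsilon> < 1" and k: "0 < k" "k \<le> card A" "k \<le> card B" "card A \<le> n"
    and large: "- ln (\<epsilon> / 6) \<le> \<epsilon> / 12 * ln (real n)"
    and p: "0 \<le> p" "p \<le> 1" "(1 + \<epsilon>) * ln (real n) / real k \<le> p"
  shows "measure_pmf.prob (bernoulli_field I p)
           {f. \<exists>T\<subseteq>A. T \<noteq> {} \<and> real (card T) \<le> \<epsilon> / 24 * real k \<and>
              real (card {y \<in> B. \<exists>x\<in>T. f (g x y)}) \<le> real (card B) * real (card T) / real (card A)}
         \<le> exp (real n powr (- (\<epsilon> / 2))) - 1"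
proof -
  let ?P = "bernoulli_field I p"
  let ?w = "real n powr (- (1 + \<epsilon> / 2))"
  let ?F = "\<lambda>T. {f. real (card {y \<in> B. \<exists>x\<in>T. f (g x y)})
                  \<le> real (card B) * real (card T) / real (card A)}"
  let ?J = "{T \<in> Pow A - {{}}. real (card T) \<le> \<epsilon> / 24 * real k}"
  have n: "1 \<le> n" using k by simp
  have "measure_pmf.prob ?P
           {f. \<exists>T\<subseteq>A. T \<noteq> {} \<and> real (card T) \<le> \<epsilon> / 24 * real k \<and>
              real (card {y \<in> B. \<exists>x\<in>T. f (g x y)}) \<le> real (card B) * real (card T) / real (card A)}
      = measure_pmf.prob ?P (\<Union>T\<in>?J. ?F T)"
    by (rule arg_cong[where f = "measure_pmf.prob ?P"]) auto
  also have "\<dots> \<le> (\<Sum>T\<in>?J. measure_pmf.prob ?P (?F T))"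
    using A by (intro measure_UNION_le) auto
  also have "\<dots> \<le> (\<Sum>T\<in>?J. ?w ^ card T)"
  proof (intro sum_mono)
    fix T assume T: "T \<in> ?J"
    \<comment> \<open>The indicators of the pairs joining \<open>y\<close> to \<open>T\<close>;
      injectivity of \<open>g\<close> makes these blocks disjoint and of size |T|.\<close>
    let ?D = "\<lambda>y. (\<lambda>x. g x y) ` T"
    have "measure_pmf.prob ?P
        {f. real (card {y \<in> B. \<exists>e\<in>?D y. f e}) \<le> real (card B) * real (card T) / real (card A)}
      \<le> ?w ^ card T"
    proof (rule prob_small_neighbourhood_le[OF I B _ _ _ eps k(1,2,3) n large _ p])
      show "?D y \<subseteq> I" if "y \<in> B" for y using T gI that by auto
      show "disjoint_family_on ?D B"
        unfolding disjoint_family_on_def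
      proof (intro ballI impI equals0I)
        fix y y' i assume y: "y \<in> B" "y' \<in> B" "y \<noteq> y'" and "i \<in> ?D y \<inter> ?D y'"
        then obtain x x' where "x \<in> T" "x' \<in> T" "g x y = g x' y'" by auto
        then show False using y T inj_onD[OF inj, of "(x, y)" "(x', y')"] by auto
      qed
      show "card (?D y) = card T" if "y \<in> B" for y
      proof (rule card_image, rule inj_onI)
        fix x x' assume "x \<in> T" "x' \<in> T" "g x y = g x' y"
        then show "x = x'" using that T inj_onD[OF inj, of "(x, y)" "(x', y)"] by auto
      qed
    qed (use T in auto)
    then show "measure_pmf.prob ?P (?F T) \<le> ?w ^ card T" by simp
  qed
  \<comment> \<open>Without the size restriction the sum has a closed form. The missing empty set
    supplies the -1 that lets the bound tend to 0.\<close>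
  also have "\<dots> \<le> (\<Sum>T\<in>Pow A - {{}}. ?w ^ card T)"
    using A by (intro sum_mono2) auto
  also have "\<dots> = (1 + ?w) ^ card A - 1"
    using A sum_power_card_Pow[OF A, of ?w] by (simp add: sum_diff1)
  also have "\<dots> \<le> (1 + ?w) ^ n - 1"
    using k by (simp add: power_increasing)
  also have "\<dots> \<le> exp (real n * ?w) - 1"
    using power_mono[of "1 + ?w" "exp ?w" n] by (simp flip: exp_of_nat_mult)
  also have "real n * ?w = real n powr (- (\<epsilon> / 2))"
    using n powr_add[of "real n" 1 "- (1 + \<epsilon> / 2)"] by simp
  finally show ?thesis .
qed

section \<open>Large sets: a union bound over pairs\<close>

text \<open>If \<open>T\<close> is at most an \<epsilon>/6 fraction of \<open>Y\<close>, then
  \<open>S\<close> is nearly all of \<open>X\<close>: a fixed pair has probability at most u w^|T|,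
  where \<open>u\<close> beats the 2^k choices of \<open>S\<close> and w < 1/n (for n > 1) handles
  the sum over \<open>T\<close>. Otherwise |S||T| is of order kn, and the resulting \<open>v\<close>
  beats the number of all pairs.\<close>

lemma prob_exists_large_nonadjacent_le:
  fixes \<epsilon> p :: real and X :: "'a set" and Y :: "'b set" and k n :: nat
  defines "c \<equiv> \<epsilon> / 24"
  assumes X: "finite X" "card X = k" and Y: "finite Y" "card Y = n"
    and eps: "0 < \<epsilon>" "\<epsilon> < 1" and k: "0 < k" "k \<le> n"
    and p: "0 \<le> p" "p \<le> 1" "(1 + \<epsilon>) * ln (real n) / real k \<le> p"
  shows "measure_pmf.prob (bernoulli_field (X \<times> Y) p)
           {f. \<exists>S\<subseteq>X. \<exists>T\<subseteq>Y. c * real k \<le> real (card S) \<and> c * real k \<le> real (card T) \<and>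
              1 < real (card S) / real k + real (card T) / real n \<and> (\<forall>e\<in>S \<times> T. \<not> f e)}
         \<le> (2 * real n powr (- (\<epsilon> / 4 * c))) ^ k * exp (real n powr (- (\<epsilon> / 4)))
           + (4 * real n powr (- (\<epsilon> / 6 * c))) ^ n"
proof -
  let ?P = "bernoulli_field (X \<times> Y) p"
  define L where "L = ln (real n)"
  define w where "w = real n powr (- (1 + \<epsilon> / 4))"
  define u where "u = (real n powr (- (\<epsilon> / 4 * c))) ^ k"
  define v where "v = (real n powr (- (\<epsilon> / 6 * c))) ^ n"
  have n: "1 \<le> n" using k by simp
  have L: "0 \<le> L" using n by (simp add: L_def)
  have c: "0 < c" using eps by (simp add: c_def)
  have uv: "0 \<le> u" "0 \<le> v" "0 \<le> w" by (auto simp: u_def v_def w_def)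
  let ?J = "{ST \<in> Pow X \<times> Pow Y. c * real k \<le> real (card (fst ST)) \<and> c * real k \<le> real (card (snd ST)) \<and>
              1 < real (card (fst ST)) / real k + real (card (snd ST)) / real n}"
  let ?F = "\<lambda>ST. {f. \<forall>e\<in>fst ST \<times> snd ST. \<not> f e}"
  \<comment> \<open>Each case below needs only one summand; adding both gives a bound uniform over
    \<open>?J\<close>.\<close>
  have pair: "measure_pmf.prob ?P (?F ST) \<le> u * w ^ card (snd ST) + v" if "ST \<in> ?J" for ST
  proof -
    define s where "s = real (card (fst ST))"
    define t where "t = real (card (snd ST))"
    have s: "c * real k \<le> s" and t: "c * real k \<le> t" and st: "1 < s / real k + t / real n"
      using that by (auto simp: s_def t_def)
    have "measure_pmf.prob ?P (?F ST) = (1 - p) ^ (card (fst ST) * card (snd ST))"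
      using that X Y p by (subst prob_bernoulli_field_all_False) (auto simp: card_cartesian_product)
    also have "\<dots> \<le> exp (- ((1 + \<epsilon>) * L / real k * (s * t)))"
      using one_minus_power_le_exp[OF p(3) p(2), of "card (fst ST) * card (snd ST)"]
      by (simp add: s_def t_def L_def)
    finally have le: "measure_pmf.prob ?P (?F ST) \<le> exp (- ((1 + \<epsilon>) * (s / real k) * (t * L)))"
      by (simp add: mult_ac)
    have tL: "0 \<le> t * L" using L by (simp add: t_def)
    show ?thesis
    proof (cases "t \<le> \<epsilon> / 6 * real n")
      case True
      then have "t / real n \<le> \<epsilon> / 6" using n by (simp add: field_simps)
      then have "1 - \<epsilon> / 6 \<le> s / real k" using st by linarith
      then have "(1 + \<epsilon>) * (1 - \<epsilon> / 6) \<le> (1 + \<epsilon>) * (s / real k)"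
        using eps by (intro mult_left_mono) auto
      moreover have "1 + \<epsilon> / 2 \<le> (1 + \<epsilon>) * (1 - \<epsilon> / 6)"
      proof -
        have "\<epsilon> * \<epsilon> \<le> \<epsilon> * 1" using eps by (intro mult_left_mono) auto
        moreover have "(1 + \<epsilon>) * (1 - \<epsilon> / 6) = 1 + \<epsilon> - \<epsilon> / 6 - \<epsilon> * \<epsilon> / 6"
          by (simp add: field_simps)
        ultimately show ?thesis using eps by linarith
      qed
      ultimately have "(1 + \<epsilon> / 2) * (t * L) \<le> (1 + \<epsilon>) * (s / real k) * (t * L)"
        using tL by (intro mult_right_mono) auto
      \<comment> \<open>The surplus \<epsilon>/2 over exponent 1 is halved: one half, with
        \<open>t\<close> at least \<open>c * real k\<close>, pays for \<open>u\<close>; the other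
        stays in \<open>w\<close>.\<close>
      moreover have "\<epsilon> / 4 * (c * real k * L) \<le> \<epsilon> / 4 * (t * L)"
        using t L eps by (intro mult_left_mono mult_right_mono) auto
      ultimately have "- ((1 + \<epsilon>) * (s / real k) * (t * L))
          \<le> - (\<epsilon> / 4 * (c * real k * L)) - (1 + \<epsilon> / 4) * (t * L)"
        by (simp add: algebra_simps)
      then have "measure_pmf.prob ?P (?F ST)
          \<le> exp (- (\<epsilon> / 4 * (c * real k * L)) - (1 + \<epsilon> / 4) * (t * L))"
        using le by (meson exp_le_cancel_iff order_trans)
      also have "\<dots> = exp (- (\<epsilon> / 4 * (c * real k * L))) * exp (- ((1 + \<epsilon> / 4) * (t * L)))"
        by (simp flip: exp_add)
      also have "\<dots> = u * w ^ card (snd ST)"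
        using n by (simp add: u_def w_def powr_power_eq_exp L_def t_def mult_ac del: minus_add_distrib)
      finally show ?thesis using uv by simp
    next
      case False
      have "c * (\<epsilon> / 6 * real n * L) \<le> (1 + \<epsilon>) * (s / real k) * (t * L)"
      proof (intro mult_mono)
        have "1 * c \<le> (1 + \<epsilon>) * (s / real k)"
          using s c eps k by (intro mult_mono) (auto simp: field_simps)
        then show "c \<le> (1 + \<epsilon>) * (s / real k)" by simp
      qed (use False L eps in \<open>auto simp: s_def t_def\<close>)
      then have "measure_pmf.prob ?P (?F ST) \<le> exp (- (c * (\<epsilon> / 6 * real n * L)))"
        using le by (meson exp_le_cancel_iff neg_le_iff_le order_trans)
      also have "\<dots> = v"
        using n by (simp add: v_def powr_power_eq_exp L_def mult_ac)
      finally show ?thesis using uv by (simp add: add_increasing)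
    qed
  qed
  have "measure_pmf.prob ?P
           {f. \<exists>S\<subseteq>X. \<exists>T\<subseteq>Y. c * real k \<le> real (card S) \<and> c * real k \<le> real (card T) \<and>
              1 < real (card S) / real k + real (card T) / real n \<and> (\<forall>e\<in>S \<times> T. \<not> f e)}
      \<le> measure_pmf.prob ?P (\<Union>ST\<in>?J. ?F ST)"
  proof (intro measure_pmf.finite_measure_mono subsetI; (elim CollectE exE conjE)?)
    fix f S T
    assume "S \<subseteq> X" "T \<subseteq> Y" "c * real k \<le> real (card S)" "c * real k \<le> real (card T)"
      "1 < real (card S) / real k + real (card T) / real n" "\<forall>e\<in>S \<times> T. \<not> f e"
    then show "f \<in> (\<Union>ST\<in>?J. ?F ST)" by (intro UN_I[of "(S, T)"]) auto
  qed simp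
  also have "\<dots> \<le> (\<Sum>ST\<in>?J. measure_pmf.prob ?P (?F ST))"
    using X Y by (intro measure_UNION_le) auto
  also have "\<dots> \<le> (\<Sum>ST\<in>?J. u * w ^ card (snd ST) + v)"
    by (intro sum_mono pair)
  also have "\<dots> \<le> (\<Sum>ST\<in>Pow X \<times> Pow Y. u * w ^ card (snd ST) + v)"
    using X Y uv by (intro sum_mono2) auto
  also have "\<dots> = (\<Sum>S\<in>Pow X. \<Sum>T\<in>Pow Y. u * w ^ card T + v)"
    by (subst sum.cartesian_product) (simp add: case_prod_beta')
  also have "\<dots> = 2 ^ k * (u * (1 + w) ^ n + 2 ^ n * v)"
    using X Y by (simp add: sum.distrib card_Pow sum_power_card_Pow flip: sum_distrib_left)
  also have "\<dots> \<le> 2 ^ k * u * exp (real n powr (- (\<epsilon> / 4))) + 4 ^ n * v"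
  proof -
    have "(1 + w) ^ n \<le> exp (real n * w)"
      using power_mono[of "1 + w" "exp w" n] uv by (simp flip: exp_of_nat_mult)
    also have "real n * w = real n powr (- (\<epsilon> / 4))"
      using n powr_add[of "real n" 1 "- (1 + \<epsilon> / 4)"] by (simp add: w_def)
    finally have "2 ^ k * u * (1 + w) ^ n \<le> 2 ^ k * u * exp (real n powr (- (\<epsilon> / 4)))"
      using uv by (intro mult_left_mono) auto
    \<comment> \<open>As \<open>k <= n\<close>, there are at most 4^n pairs.\<close>
    moreover have "(2 :: real) ^ k * 2 ^ n \<le> 2 ^ n * 2 ^ n"
      using k by (intro mult_right_mono power_increasing) auto
    then have "2 ^ k * 2 ^ n * v \<le> 4 ^ n * v"
      using uv by (intro mult_right_mono) (auto simp flip: power_mult_distrib)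
    ultimately show ?thesis by (simp add: algebra_simps)
  qed
  finally show ?thesis by (simp add: u_def v_def power_mult_distrib)
qed

section \<open>Above the threshold: combining the three cases\<close>

lemma prob_NMP_eq:
  "prob_NMP k n p = measure_pmf.prob (bernoulli_field ({..<k} \<times> {..<n}) p)
     {f. NMP {..<k} {..<n} {e. f e}}"
  by (simp add: prob_NMP_def random_bip_def vimage_def)

text \<open>When \<open>S\<close> is small, its neighbourhood avoids \<open>T\<close>, so the size
  inequality bounds that neighbourhood in terms of |S| alone. \<open>T\<close> then drops out of the
  event, and a union bound over \<open>S\<close> is enough. The case of small \<open>T\<close> is
  symmetric.\<close>

lemma not_NMP_cases:
  fixes f :: "'a \<times> 'b \<Rightarrow> bool" and c :: real
  assumes X: "finite X" "X \<noteq> {}" and Y: "finite Y" "Y \<noteq> {}" and fail: "\<not> NMP X Y {e. f e}"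
  obtains
    (small_left) S where "S \<subseteq> X" "S \<noteq> {}" "real (card S) \<le> c"
      "real (card {y \<in> Y. \<exists>x\<in>S. f (x, y)}) \<le> real (card Y) * real (card S) / real (card X)"
  | (small_right) T where "T \<subseteq> Y" "T \<noteq> {}" "real (card T) \<le> c"
      "real (card {x \<in> X. \<exists>y\<in>T. f (x, y)}) \<le> real (card X) * real (card T) / real (card Y)"
  | (large) S T where "S \<subseteq> X" "T \<subseteq> Y" "c \<le> real (card S)" "c \<le> real (card T)"
      "1 < real (card S) / real (card X) + real (card T) / real (card Y)" "\<forall>e\<in>S \<times> T. \<not> f e"
proof -
  obtain S T where S: "S \<subseteq> X" and T: "T \<subseteq> Y" and ne: "S \<noteq> {}" "T \<noteq> {}"
    and no: "\<And>x y. x \<in> S \<Longrightarrow> y \<in> T \<Longrightarrow> (x, y) \<notin> {e. f e}"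
    and gt: "1 < real (card S) / real (card X) + real (card T) / real (card Y)"
    by (rule not_NMP_obtain[OF X Y fail]) blast
  have pos: "0 < real (card X)" "0 < real (card Y)" using X Y by (auto simp: card_gt_0_iff)
  consider "real (card S) \<le> c" | "real (card T) \<le> c" | "c \<le> real (card S)" "c \<le> real (card T)"
    by linarith
  then show ?thesis
  proof cases
    case 1
    have "card {y \<in> Y. \<exists>x\<in>S. f (x, y)} \<le> card (Y - T)"
      using Y no by (intro card_mono) auto
    then have "real (card {y \<in> Y. \<exists>x\<in>S. f (x, y)}) \<le> real (card Y) - real (card T)"
      using card_mono[OF Y(1) T] card_Diff_subset[OF finite_subset[OF T Y(1)] T] by linarith
    also have "\<dots> \<le> real (card Y) * real (card S) / real (card X)"
      using gt pos by (simp add: field_simps)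
    finally show ?thesis using small_left S ne 1 by blast
  next
    case 2
    have "card {x \<in> X. \<exists>y\<in>T. f (x, y)} \<le> card (X - S)"
      using X no by (intro card_mono) auto
    then have "real (card {x \<in> X. \<exists>y\<in>T. f (x, y)}) \<le> real (card X) - real (card S)"
      using card_mono[OF X(1) S] card_Diff_subset[OF finite_subset[OF S X(1)] S] by linarith
    also have "\<dots> \<le> real (card X) * real (card T) / real (card Y)"
      using gt pos by (simp add: field_simps)
    finally show ?thesis using small_right T ne 2 by blast
  next
    case 3
    then show ?thesis using large[OF S T 3 gt] no by auto
  qed
qed

text \<open>The first term appears twice, for small sets in either class. The exponents of the other
  two are \<epsilon>/4 and \<epsilon>/6 times the cutoff constant \<epsilon>/24.\<close>

lemma prob_not_NMP_le:
  fixes \<epsilon> p :: real and k n :: nat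
  assumes eps: "0 < \<epsilon>" "\<epsilon> < 1" and k: "0 < k" "k \<le> n"
    and large: "- ln (\<epsilon> / 6) \<le> \<epsilon> / 12 * ln (real n)"
    and p: "0 \<le> p" "p \<le> 1" "(1 + \<epsilon>) * ln (real n) / real k \<le> p"
  shows "1 - prob_NMP k n p \<le> 2 * (exp (real n powr (- (\<epsilon> / 2))) - 1)
    + (2 * real n powr (- (\<epsilon>\<^sup>2 / 96))) ^ k * exp (real n powr (- (\<epsilon> / 4)))
    + (4 * real n powr (- (\<epsilon>\<^sup>2 / 144))) ^ n"
proof -
  let ?X = "{..<k}" and ?Y = "{..<n}"
  let ?P = "bernoulli_field (?X \<times> ?Y) p"
  let ?c = "\<epsilon> / 24 * real k"
  let ?A = "{f :: nat \<times> nat \<Rightarrow> bool. \<exists>S\<subseteq>?X. S \<noteq> {} \<and> real (card S) \<le> ?c \<and>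
      real (card {y \<in> ?Y. \<exists>x\<in>S. f (x, y)}) \<le> real (card ?Y) * real (card S) / real (card ?X)}"
  let ?B = "{f :: nat \<times> nat \<Rightarrow> bool. \<exists>T\<subseteq>?Y. T \<noteq> {} \<and> real (card T) \<le> ?c \<and>
      real (card {x \<in> ?X. \<exists>y\<in>T. f (x, y)}) \<le> real (card ?X) * real (card T) / real (card ?Y)}"
  let ?C = "{f :: nat \<times> nat \<Rightarrow> bool. \<exists>S\<subseteq>?X. \<exists>T\<subseteq>?Y. ?c \<le> real (card S) \<and> ?c \<le> real (card T) \<and>
      1 < real (card S) / real k + real (card T) / real n \<and> (\<forall>e\<in>S \<times> T. \<not> f e)}"
  have A: "measure_pmf.prob ?P ?A \<le> exp (real n powr (- (\<epsilon> / 2))) - 1"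
    by (rule prob_exists_small_deficient_le[where g = Pair])
      (use eps k large p in \<open>auto simp: inj_on_def\<close>)
  \<comment> \<open>Swapping the pair makes \<open>?Y\<close> the class that contains the small
    set.\<close>
  have B: "measure_pmf.prob ?P ?B \<le> exp (real n powr (- (\<epsilon> / 2))) - 1"
    by (rule prob_exists_small_deficient_le[where g = "\<lambda>y x. (x, y)"])
      (use eps k large p in \<open>auto simp: inj_on_def\<close>)
  have C: "measure_pmf.prob ?P ?C
      \<le> (2 * real n powr (- (\<epsilon>\<^sup>2 / 96))) ^ k * exp (real n powr (- (\<epsilon> / 4)))
        + (4 * real n powr (- (\<epsilon>\<^sup>2 / 144))) ^ n"
    using prob_exists_large_nonadjacent_le[of ?X k ?Y n \<epsilon> p] eps k p
    by (simp add: power2_eq_square)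
  have "1 - prob_NMP k n p = measure_pmf.prob ?P {f. \<not> NMP ?X ?Y {e. f e}}"
    by (simp add: prob_NMP_eq measure_pmf.prob_compl[symmetric] Compl_eq_Diff_UNIV[symmetric]
        Collect_neg_eq)
  also have "\<dots> \<le> measure_pmf.prob ?P (?A \<union> ?B \<union> ?C)"
  proof (intro measure_pmf.finite_measure_mono subsetI)
    fix f :: "nat \<times> nat \<Rightarrow> bool" assume "f \<in> {f. \<not> NMP ?X ?Y {e. f e}}"
    then have fail: "\<not> NMP ?X ?Y {e. f e}" by simp
    have ne: "?X \<noteq> {}" "?Y \<noteq> {}" using k by (auto simp: lessThan_empty_iff)
    show "f \<in> ?A \<union> ?B \<union> ?C"
    proof (cases rule: not_NMP_cases[OF finite_lessThan ne(1) finite_lessThan ne(2) fail,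
          of ?c, case_names small_left small_right large])
      case (small_left S)
      then have "f \<in> ?A" by blast
      then show ?thesis by blast
    next
      case (small_right T)
      then have "f \<in> ?B" by blast
      then show ?thesis by blast
    next
      case (large S T)
      then have "f \<in> ?C" unfolding card_lessThan by blast
      then show ?thesis by blast
    qed
  qed simp
  also have "\<dots> \<le> measure_pmf.prob ?P ?A + measure_pmf.prob ?P ?B + measure_pmf.prob ?P ?C"
    by (intro order_trans[OF measure_Un_le] add_right_mono measure_Un_le) auto
  also note add_mono[OF add_mono[OF A B] C]
  finally show ?thesis by (simp only: mult_2 add.assoc)
qed

section \<open>Below the threshold: isolated vertices\<close>

text \<open>NMP for S = X forces every vertex of \<open>Y\<close> to have a neighbour. The stars at
  these vertices are disjoint blocks of size \<open>k\<close>, so the probability that all are hit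
  is exact.\<close>

lemma prob_NMP_le_no_isolated:
  assumes "0 < k" "0 < n" "0 \<le> p" "p \<le> 1"
  shows "prob_NMP k n p \<le> (1 - (1 - p) ^ k) ^ n"
proof -
  let ?X = "{..<k}" and ?Y = "{..<n}"
  let ?P = "bernoulli_field (?X \<times> ?Y) p"
  let ?D = "\<lambda>y :: nat. (\<lambda>x. (x, y)) ` ?X"
  have "prob_NMP k n p \<le> measure_pmf.prob ?P {f. \<forall>y\<in>?Y. \<exists>e\<in>?D y. f e}"
    unfolding prob_NMP_eq
  proof (intro measure_pmf.finite_measure_mono subsetI)
    fix f :: "nat \<times> nat \<Rightarrow> bool" assume "f \<in> {f. NMP ?X ?Y {e. f e}}"
    then have "real (card ?X) / real (card ?X)
        \<le> real (card (bip_neighbours ?Y {e. f e} ?X)) / real (card ?Y)"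
      unfolding NMP_def by blast
    then have "card ?Y \<le> card (bip_neighbours ?Y {e. f e} ?X)"
      using assms by (simp add: field_simps)
    then have "bip_neighbours ?Y {e. f e} ?X = ?Y"
      by (intro card_seteq) (auto simp: bip_neighbours_def)
    then show "f \<in> {f. \<forall>y\<in>?Y. \<exists>e\<in>?D y. f e}" by (auto simp: bip_neighbours_def)
  qed simp
  also have "\<dots> = (1 - (1 - p) ^ k) ^ card ?Y"
    by (rule prob_all_blocks_hit)
      (use assms in \<open>auto simp: disjoint_family_on_def card_image inj_on_def\<close>)
  finally show ?thesis by simp
qed

text \<open>For q at most \<epsilon>/(1 + \<epsilon>) one has 1 - q >= exp(-(1 + \<epsilon>)q). At
  the threshold value \<open>q\<close> the exponent becomes (1 + \<epsilon>)(1 - \<epsilon>) ln n,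
  so the mean number n(1 - p)^k of isolated vertices is at least n^(\<epsilon>^2).\<close>

lemma prob_NMP_le_exp:
  fixes \<epsilon> p :: real and k n :: nat
  assumes eps: "0 < \<epsilon>" "\<epsilon> < 1" and k: "0 < k" "0 < n"
    and small: "ln (real n) / real k \<le> \<epsilon> / (1 + \<epsilon>)"
    and p: "0 \<le> p" "p \<le> 1" "p \<le> (1 - \<epsilon>) * ln (real n) / real k"
  shows "prob_NMP k n p \<le> exp (- (real n powr \<epsilon>\<^sup>2))"
proof -
  define q where "q = (1 - \<epsilon>) * ln (real n) / real k"
  have "q \<le> 1 * (ln (real n) / real k)"
    unfolding q_def times_divide_eq_right[symmetric]
    using eps k by (intro mult_right_mono) auto
  then have q: "q \<le> \<epsilon> / (1 + \<epsilon>)" using small by simp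
  have q0: "0 \<le> q" using eps k by (simp add: q_def)
  have "\<epsilon> / (1 + \<epsilon>) < 1" using eps by simp
  then have q1: "q < 1" using q by simp
  \<comment> \<open>This is what makes (1 - q)(1 + (1 + \<epsilon>)q) = 1 + q(\<epsilon> - (1 +
    \<epsilon>)q) at least 1.\<close>
  have "q * (1 + \<epsilon>) \<le> \<epsilon>" using q eps by (simp add: field_simps)
  then have "q * (q * (1 + \<epsilon>)) \<le> q * \<epsilon>" using q0 by (intro mult_left_mono)
  then have "1 \<le> (1 - q) * (1 + (1 + \<epsilon>) * q)" by (simp add: algebra_simps)
  also have "\<dots> \<le> (1 - q) * exp ((1 + \<epsilon>) * q)"
    using q1 exp_ge_add_one_self[of "(1 + \<epsilon>) * q"] by (intro mult_left_mono) auto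
  finally have "1 / exp ((1 + \<epsilon>) * q) \<le> 1 - q" by (subst pos_divide_le_eq) auto
  then have "exp (- ((1 + \<epsilon>) * q)) \<le> 1 - q" by (simp add: exp_minus inverse_eq_divide)
  also have "\<dots> \<le> 1 - p" using p by (simp add: q_def)
  finally have "exp (- ((1 + \<epsilon>) * q)) ^ k \<le> (1 - p) ^ k" by (intro power_mono) auto
  also have "exp (- ((1 + \<epsilon>) * q)) ^ k = exp (- ((1 + \<epsilon>) * (1 - \<epsilon>) * ln (real n)))"
    using k by (simp add: q_def field_simps flip: exp_of_nat_mult)
  also have "\<dots> = real n powr (\<epsilon>\<^sup>2 - 1)"
    using k by (simp add: powr_def power2_eq_square algebra_simps)
  finally have "real n * real n powr (\<epsilon>\<^sup>2 - 1) \<le> real n * (1 - p) ^ k"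
    by (intro mult_left_mono) auto
  then have *: "real n powr \<epsilon>\<^sup>2 \<le> real n * (1 - p) ^ k"
    using k powr_add[of "real n" 1 "\<epsilon>\<^sup>2 - 1"] by simp
  have "prob_NMP k n p \<le> (1 - (1 - p) ^ k) ^ n"
    using k p by (intro prob_NMP_le_no_isolated) auto
  also have "\<dots> \<le> exp (- ((1 - p) ^ k)) ^ n"
    using p exp_ge_add_one_self[of "- ((1 - p) ^ k)"] by (intro power_mono) (auto simp: power_le_one)
  also have "\<dots> = exp (- (real n * (1 - p) ^ k))" by (simp flip: exp_of_nat_mult)
  also have "\<dots> \<le> exp (- (real n powr \<epsilon>\<^sup>2))" using * by simp
  finally show ?thesis .
qed

section \<open>Passage to large \<open>k\<close>\<close>

theorem theorem1p2:
  fixes n :: "nat \<Rightarrow> nat" and \<epsilon> \<delta> :: real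
  assumes n_lower: "\<And>k. k \<le> n k"
    and n_upper: "(\<lambda>k. ln (real (n k)) / real k) \<longlonglongrightarrow> 0"
    and eps: "0 < \<epsilon>" "\<epsilon> < 1"
    and del: "0 < \<delta>" "\<delta> < 1"
  shows "\<exists>k0. \<forall>k\<ge>k0. \<forall>p::real. 0 \<le> p \<and> p \<le> 1 \<longrightarrow>
           (p \<ge> (1 + \<epsilon>) * ln (real (n k)) / real k \<longrightarrow> prob_NMP k (n k) p \<ge> 1 - \<delta>) \<and>
           (p \<le> (1 - \<epsilon>) * ln (real (n k)) / real k \<longrightarrow> prob_NMP k (n k) p \<le> \<delta>)"
proof -
  let ?n = "\<lambda>k. real (n k)"
  have n_top: "filterlim ?n at_top sequentially"
    by (rule filterlim_at_top_mono[OF filterlim_real_sequentially]) (use n_lower in auto)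
  have zero: "(\<lambda>k. ?n k powr (- a)) \<longlonglongrightarrow> 0" if "0 < a" for a
    using that n_top by (intro tendsto_neg_powr) auto
  \<comment> \<open>The finite bound with its exponents \<open>k\<close> and \<open>n k\<close>
    replaced by 1, so that limit rules apply directly. The replacement is valid once both bases are
    below 1, which \<open>ev2\<close> and \<open>ev3\<close> provide.\<close>
  let ?bound = "\<lambda>k. 2 * (exp (?n k powr (- (\<epsilon> / 2))) - 1)
    + (2 * ?n k powr (- (\<epsilon>\<^sup>2 / 96))) * exp (?n k powr (- (\<epsilon> / 4)))
    + (4 * ?n k powr (- (\<epsilon>\<^sup>2 / 144)))"
  have "?bound \<longlonglongrightarrow> 2 * (exp 0 - 1) + (2 * 0) * exp 0 + 4 * 0"
    using eps by (intro tendsto_intros zero) auto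
  then have "?bound \<longlonglongrightarrow> 0" by simp
  then have ev1: "\<forall>\<^sub>F k in sequentially. ?bound k < \<delta>"
    using del by (intro order_tendstoD(2)) auto
  have "(\<lambda>k. 2 * ?n k powr (- (\<epsilon>\<^sup>2 / 96))) \<longlonglongrightarrow> 2 * 0"
    using eps by (intro tendsto_intros zero) auto
  then have ev2: "\<forall>\<^sub>F k in sequentially. 2 * ?n k powr (- (\<epsilon>\<^sup>2 / 96)) < 1"
    by (rule order_tendstoD(2)) auto
  have "(\<lambda>k. 4 * ?n k powr (- (\<epsilon>\<^sup>2 / 144))) \<longlonglongrightarrow> 4 * 0"
    using eps by (intro tendsto_intros zero) auto
  then have ev3: "\<forall>\<^sub>F k in sequentially. 4 * ?n k powr (- (\<epsilon>\<^sup>2 / 144)) < 1"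
    by (rule order_tendstoD(2)) auto
  have ln_top: "filterlim (\<lambda>k. a * ln (?n k)) at_top sequentially" if "0 < a" for a
    using that by (intro filterlim_tendsto_pos_mult_at_top[OF tendsto_const]
        filterlim_compose[OF ln_at_top n_top]) auto
  have ev4: "\<forall>\<^sub>F k in sequentially. - ln (\<epsilon> / 6) \<le> \<epsilon> / 12 * ln (?n k)"
    using eps by (intro filterlim_at_top[THEN iffD1, THEN spec] ln_top) auto
  have ev5: "\<forall>\<^sub>F k in sequentially. ln (?n k) / real k < \<epsilon> / (1 + \<epsilon>)"
    using eps by (intro order_tendstoD(2)[OF n_upper]) auto
  \<comment> \<open>Through x <= exp x, this makes n^(\<epsilon>^2) at least -ln \<delta>, so
    exp(-n^(\<epsilon>^2)) is at most \<delta>.\<close>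
  have ev6: "\<forall>\<^sub>F k in sequentially. - ln \<delta> \<le> \<epsilon>\<^sup>2 * ln (?n k)"
    using eps by (intro filterlim_at_top[THEN iffD1, THEN spec] ln_top) auto
  have "\<forall>\<^sub>F k in sequentially. \<forall>p::real. 0 \<le> p \<and> p \<le> 1 \<longrightarrow>
           (p \<ge> (1 + \<epsilon>) * ln (?n k) / real k \<longrightarrow> prob_NMP k (n k) p \<ge> 1 - \<delta>) \<and>
           (p \<le> (1 - \<epsilon>) * ln (?n k) / real k \<longrightarrow> prob_NMP k (n k) p \<le> \<delta>)"
    using ev1 ev2 ev3 ev4 ev5 ev6 eventually_gt_at_top[of 0]
  proof eventually_elim
    case (elim k)
    have kn: "0 < k" "k \<le> n k" "0 < n k" using elim(7) n_lower[of k] by auto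
    show ?case
    proof (intro allI impI conjI; elim conjE)
      fix p assume p: "0 \<le> p" "p \<le> 1" "(1 + \<epsilon>) * ln (?n k) / real k \<le> p"
      have "(2 * ?n k powr (- (\<epsilon>\<^sup>2 / 96))) ^ k * exp (?n k powr (- (\<epsilon> / 4)))
          \<le> (2 * ?n k powr (- (\<epsilon>\<^sup>2 / 96))) ^ 1 * exp (?n k powr (- (\<epsilon> / 4)))"
        using elim(2) kn by (intro mult_right_mono power_decreasing) auto
      moreover have "(4 * ?n k powr (- (\<epsilon>\<^sup>2 / 144))) ^ n k \<le> (4 * ?n k powr (- (\<epsilon>\<^sup>2 / 144))) ^ 1"
        using elim(3) kn by (intro power_decreasing) auto
      ultimately show "1 - \<delta> \<le> prob_NMP k (n k) p"
        using prob_not_NMP_le[OF eps kn(1,2) elim(4) p] elim(1)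
        unfolding power_one_right by linarith
    next
      fix p assume p: "0 \<le> p" "p \<le> 1" "p \<le> (1 - \<epsilon>) * ln (?n k) / real k"
      have "\<epsilon>\<^sup>2 * ln (?n k) \<le> exp (\<epsilon>\<^sup>2 * ln (?n k))"
        using exp_ge_add_one_self[of "\<epsilon>\<^sup>2 * ln (?n k)"] by linarith
      also have "\<dots> = ?n k powr \<epsilon>\<^sup>2" using kn by (simp add: powr_def)
      finally have "\<epsilon>\<^sup>2 * ln (?n k) \<le> ?n k powr \<epsilon>\<^sup>2" .
      then have "exp (- (?n k powr \<epsilon>\<^sup>2)) \<le> exp (ln \<delta>)"
        using elim(6) by (subst exp_le_cancel_iff) linarith
      moreover have "prob_NMP k (n k) p \<le> exp (- (?n k powr \<epsilon>\<^sup>2))"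
        using elim(5) by (intro prob_NMP_le_exp[OF eps kn(1,3) _ p]) auto
      ultimately show "prob_NMP k (n k) p \<le> \<delta>" using del by simp
    qed
  qed
  then show ?thesis by (simp add: eventually_sequentially)
qed

end
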